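(* Let $n,p,q$ be positive integers with $n>q$, and let $\pi_{\mathrm{DASEP}}$ be the unnormalized stationary distribution of $\mathrm{DASEP}(n,p,q)$. (1) For any two binary words $w,w'\in S_n(1^q0^{n-q})$ (viewed as states of $\mathrm{DASEP}(n,p,q)$ in which all particles have species $1$), $\pi_{\mathrm{DASEP}}(w)=\pi_{\mathrm{DASEP}}(w')$. (2) For any binary word $w\in S_n(1^q0^{n-q})$ and any partition $\lambda=\langle 1^{m_1}2^{m_2}\cdots p^{m_p}\rangle$ with $m_1+\cdots+m_p=q$, $$\sum_{\mu\in S_n^w(\lambda)}\pi_{\mathrm{DASEP}}(\mu)=u^{|\lambda|-q}\,|S_n^w(\lambda)|\,\pi_{\mathrm{DASEP}}(w)=u^{|\lambda|-q}\binom{q}{m_1,m_2,\dots,m_p}\pi_{\mathrm{DASEP}}(w).$$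
   Context: A partition $\lambda$ is written as an $n$-tuple $(\lambda_1\ge\cdots\ge\lambda_n\ge0)$; $|\lambda|=\sum\lambda_i$, $m_i=m_i(\lambda)$ is the number of parts equal to $i$, $\ell(\lambda)$ is the number of positive parts, and $\lambda=\langle 1^{m_1}2^{m_2}\cdots\rangle$. $S_n(\lambda)$ is the set of all distinct rearrangements of $(\lambda_1,\dots,\lambda_n)$. Binary words are elements of $S_n(1^q0^{n-q})$. For a binary word $w=(w_1,\dots,w_n)$, $S_n^w(\lambda)=\{\mu\in S_n(\lambda):\mu_i\neq0\iff w_i\neq0\}$. $\mathrm{DASEP}(n,p,q)$ (doubly asymmetric simple exclusion process), for $n>q$ and parameters $t,u$ (constants in $[0,1]$, treated as formal variables): its state space $\Gamma^{p,q}_n=\bigcup_{\lambda_1\le p,\ \ell(\lambda)=q}S_n(\lambda)$ is the set of $n$-tuples with entries in $\{0,1,\dots,p\}$ having exactly $q$ nonzero entries (sites on a ring; $0$ is a hole, $i\ge1$ a particle of species $i$). Positions are read cyclically, position $n$ being followed by position $1$. Transition probabilities $P(\mu,\nu)$: (i) if $\nu$ is obtained from $\mu$ by swapping the entries $a=\mu_k$, $b=\mu_{k+1}$ at cyclically consecutive positions $k,k+1$ (indices mod $n$) with $a\ne b$, then $P(\mu,\nu)=\frac{1}{3n}$ if $b>a$ and $\frac{t}{3n}$ if $a>b$; (ii) if $\nu$ is obtained from $\mu$ by changing one entry equal to $i$, $1\le i\le p-1$, to $i+1$, then $P(\mu,\nu)=\frac{u}{3n}$; (iii) if $\nu$ is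 obtained from $\mu$ by changing one entry equal to $i+1$, $i\ge1$, to $i$, then $P(\mu,\nu)=\frac{1}{3n}$; all other off-diagonal probabilities are $0$ and $P(\mu,\mu)=1-\sum_{\nu\ne\mu}P(\mu,\nu)$. The unnormalized stationary distribution $\pi_{\mathrm{DASEP}}$ is the stationary measure whose values are polynomials in $u,t$ with greatest common divisor $1$. *)

theory Defs
  imports
    "HOL-Computational_Algebra.Computational_Algebra"
    "HOL-Computational_Algebra.Field_as_Ring"
    "HOL-Combinatorics.Multiset_Permutations"
begin

text \<open>
  A partition is an \<open>n\<close>-tuple of naturals in weakly decreasing order, padded with zeros;
  so the size of \<open>lam\<close> is \<^const>\<open>sum_list\<close>, and \<open>m\<^sub>i\<close> is \<open>count_list lam i\<close>.
\<close>

definition is_partition :: "nat \<Rightarrow> nat list \<Rightarrow> bool" where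
  "is_partition n lam \<longleftrightarrow> length lam = n \<and> sorted_wrt (\<ge>) lam"

definition num_parts :: "nat list \<Rightarrow> nat" where
  "num_parts lam = length (filter (\<lambda>i. i > 0) lam)"

abbreviation rearrangements :: "nat list \<Rightarrow> nat list set" where
  "rearrangements lam \<equiv> permutations_of_multiset (mset lam)"

definition binary_words :: "nat \<Rightarrow> nat \<Rightarrow> nat list set" where
  "binary_words n q = rearrangements (replicate q 1 @ replicate (n - q) 0)"

definition rearrangements_supp :: "nat list \<Rightarrow> nat list \<Rightarrow> nat list set" where
  "rearrangements_supp w lam =
     {\<mu> \<in> rearrangements lam. \<forall>i < length lam. \<mu> ! i \<noteq> 0 \<longleftrightarrow> w ! i \<noteq> 0}"

text \<open>The multinomial coefficient of \<open>m\<^sub>1, \<dots>, m\<^sub>p\<close>; the division is exact.\<close>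

definition multinomial :: "nat \<Rightarrow> (nat \<Rightarrow> nat) \<Rightarrow> nat" where
  "multinomial p m = fact (\<Sum>i=1..p. m i) div (\<Prod>i=1..p. fact (m i))"

text \<open>
  The parameters \<open>t\<close> and \<open>u\<close> are formal variables: everything takes values in
  \<open>\<rat>[t][u]\<close>, the inner variable being \<open>t\<close> and the outer one \<open>u\<close>.
\<close>

type_synonym tu_poly = "rat poly poly"

definition var_u :: tu_poly where "var_u = [:0, 1:]"

definition var_t :: tu_poly where "var_t = [:[:0, 1:]:]"

definition const_tu :: "rat \<Rightarrow> tu_poly" where "const_tu c = [:[:c:]:]"

definition dasep_states :: "nat \<Rightarrow> nat \<Rightarrow> nat \<Rightarrow> nat list set" where
  "dasep_states n p q =
     (\<Union>lam \<in> {lam. is_partition n lam \<and> lam ! 0 \<le> p \<and> num_parts lam = q}. rearrangements lam)"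

text \<open>Sites are numbered \<open>0, \<dots>, n - 1\<close>, and site \<open>n - 1\<close> is followed by site \<open>0\<close>.\<close>

definition swap_next :: "nat \<Rightarrow> nat list \<Rightarrow> nat list" where
  "swap_next k \<mu> =
     (let l = Suc k mod length \<mu> in \<mu>[k := \<mu> ! l, l := \<mu> ! k])"

text \<open>
  The sum over the bonds \<open>(k, k + 1)\<close> has at most one nonzero term if \<open>n \<ge> 3\<close>. If \<open>n = 2\<close>,
  the two bonds join the same pair of sites in opposite directions and lead to the same
  state; their probabilities add up.
\<close>

definition hop_prob :: "nat \<Rightarrow> nat list \<Rightarrow> nat list \<Rightarrow> tu_poly" where
  "hop_prob n \<mu> \<nu> =
     (\<Sum>k<n. let a = \<mu> ! k; b = \<mu> ! (Suc k mod n) in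
        if a \<noteq> b \<and> \<nu> = swap_next k \<mu>
        then (if a < b then const_tu (1 / (3 * of_nat n))
              else var_t * const_tu (1 / (3 * of_nat n)))
        else 0)"

definition promotes :: "nat \<Rightarrow> nat list \<Rightarrow> nat list \<Rightarrow> bool" where
  "promotes p \<mu> \<nu> \<longleftrightarrow>
     (\<exists>k < length \<mu>. 1 \<le> \<mu> ! k \<and> \<mu> ! k \<le> p - 1 \<and> \<nu> = \<mu>[k := \<mu> ! k + 1])"

definition demotes :: "nat list \<Rightarrow> nat list \<Rightarrow> bool" where
  "demotes \<mu> \<nu> \<longleftrightarrow> (\<exists>k < length \<mu>. \<exists>i\<ge>1. \<mu> ! k = i + 1 \<and> \<nu> = \<mu>[k := i])"

text \<open>
  The three kinds of transitions exclude each other: a swap preserves the sum of the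
  entries, a promotion increases it and a demotion decreases it.
\<close>

definition dasep_offdiag :: "nat \<Rightarrow> nat \<Rightarrow> nat list \<Rightarrow> nat list \<Rightarrow> tu_poly" where
  "dasep_offdiag n p \<mu> \<nu> =
     (if promotes p \<mu> \<nu> then var_u * const_tu (1 / (3 * of_nat n))
      else if demotes \<mu> \<nu> then const_tu (1 / (3 * of_nat n))
      else hop_prob n \<mu> \<nu>)"

definition dasep_prob :: "nat \<Rightarrow> nat \<Rightarrow> nat \<Rightarrow> nat list \<Rightarrow> nat list \<Rightarrow> tu_poly" where
  "dasep_prob n p q \<mu> \<nu> =
     (if \<mu> = \<nu> then 1 - (\<Sum>\<nu>' \<in> dasep_states n p q - {\<mu>}. dasep_offdiag n p \<mu> \<nu>')
      else dasep_offdiag n p \<mu> \<nu>)"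

definition dasep_stationary :: "nat \<Rightarrow> nat \<Rightarrow> nat \<Rightarrow> (nat list \<Rightarrow> tu_poly) \<Rightarrow> bool" where
  "dasep_stationary n p q \<pi> \<longleftrightarrow>
     (\<forall>\<nu> \<in> dasep_states n p q.
        (\<Sum>\<mu> \<in> dasep_states n p q. \<pi> \<mu> * dasep_prob n p q \<mu> \<nu>) = \<pi> \<nu>)"

text \<open>
  The values of \<open>\<pi>\<close> outside the state space are irrelevant. On the state space these
  conditions determine \<open>\<pi>\<close> up to a unit of \<open>\<rat>[t][u]\<close>, i.e. up to a nonzero rational
  factor, and the gcd condition rules out \<open>\<pi> = 0\<close>.
\<close>

definition unnormalized_stationary :: "nat \<Rightarrow> nat \<Rightarrow> nat \<Rightarrow> (nat list \<Rightarrow> tu_poly) \<Rightarrow> bool" where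
  "unnormalized_stationary n p q \<pi> \<longleftrightarrow>
     dasep_stationary n p q \<pi> \<and> Gcd (\<pi> ` dasep_states n p q) = 1"

end

theory Submission
  imports Defs
begin

text \<open>
  Occupied sites together with the multiset of species evolve autonomously: the occupied sites
  perform an exclusion process on the ring, whose stationary measure is uniform, and the species
  change independently of them, reversibly with respect to the weight \<open>u\<close> to the sum of the
  species. So the class sums of \<open>\<pi>\<close> are compared with this product measure. Uniqueness is obtained
  without specialising \<open>t\<close> and \<open>u\<close>: the polynomial ring \<open>\<rat>[t][u]\<close> is a linearly ordered domain in
  which \<open>t\<close> and \<open>u\<close> are positive, so the Dirichlet form of the quotient of the two measures is a
  vanishing sum of nonnegative terms, and the quotient is constant along all transitions.
\<close>

section \<open>States and transitions\<close>

lemma num_parts_mset: "num_parts xs = size (filter_mset (\<lambda>i. i > 0) (mset xs))"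
  by (simp add: num_parts_def flip: mset_filter)

text \<open>Sorting a state in decreasing order yields its partition, whose entry
  \<open>lam ! 0\<close> is the largest; bounding that entry bounds all of them. The hypothesis
  \<open>n > 0\<close> makes this entry exist.\<close>

lemma dasep_states_iff:
  assumes "n > 0"
  shows "\<mu> \<in> dasep_states n p q \<longleftrightarrow> length \<mu> = n \<and> (\<forall>i\<in>set \<mu>. i \<le> p) \<and> num_parts \<mu> = q"
proof
  assume "\<mu> \<in> dasep_states n p q"
  then obtain lam where lam: "is_partition n lam" "lam ! 0 \<le> p" "num_parts lam = q"
      "mset \<mu> = mset lam"
    by (auto simp: dasep_states_def permutations_of_multiset_def)
  have "i \<le> p" if i: "i \<in> set lam" for i
  proof -
    obtain k where k: "k < length lam" "i = lam ! k"
      using i by (auto simp: in_set_conv_nth)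
    have "lam ! k \<le> lam ! 0"
      using lam(1) k(1) by (cases "k = 0") (auto simp: is_partition_def sorted_wrt_iff_nth_less)
    then show ?thesis
      using lam(2) k by simp
  qed
  moreover have "set \<mu> = set lam" "length \<mu> = length lam"
    using lam(4) by (metis mset_eq_setD, metis mset_eq_length)
  ultimately show "length \<mu> = n \<and> (\<forall>i\<in>set \<mu>. i \<le> p) \<and> num_parts \<mu> = q"
    using lam by (auto simp: is_partition_def num_parts_mset)
next
  assume \<mu>: "length \<mu> = n \<and> (\<forall>i\<in>set \<mu>. i \<le> p) \<and> num_parts \<mu> = q"
  let ?l = "rev (sort \<mu>)"
  have "is_partition n ?l"
    using \<mu> by (simp add: is_partition_def sorted_wrt_rev)
  moreover have "?l ! 0 \<in> set ?l"
    by (rule nth_mem) (use \<mu> assms in auto)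
  then have "?l ! 0 \<le> p"
    using \<mu> by auto
  moreover have "num_parts ?l = q"
    using \<mu> by (simp add: num_parts_mset)
  moreover have "\<mu> \<in> rearrangements ?l"
    by (simp add: permutations_of_multiset_def)
  ultimately show "\<mu> \<in> dasep_states n p q"
    unfolding dasep_states_def by blast
qed

lemma finite_dasep_states:
  assumes "n > 0"
  shows "finite (dasep_states n p q)"
proof (rule finite_subset)
  show "dasep_states n p q \<subseteq> {\<mu>. set \<mu> \<subseteq> {..p} \<and> length \<mu> = n}"
    using assms by (auto simp: dasep_states_iff)
  show "finite {\<mu>. set \<mu> \<subseteq> {..p} \<and> length \<mu> = n}"
    by (intro finite_lists_length_eq) auto
qed

lemma length_swap_next [simp]: "length (swap_next k \<mu>) = length \<mu>"
  by (simp add: swap_next_def Let_def)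

lemma Suc_mod_less: "k < n \<Longrightarrow> Suc k mod n < n"
  by (metis gr_implies_not0 mod_less_divisor neq0_conv)

lemma mset_swap_next [simp]: "k < length \<mu> \<Longrightarrow> mset (swap_next k \<mu>) = mset \<mu>"
  unfolding swap_next_def Let_def by (rule mset_swap) (auto intro: Suc_mod_less)

lemma sum_list_swap_next [simp]: "k < length \<mu> \<Longrightarrow> sum_list (swap_next k \<mu>) = sum_list \<mu>"
  by (metis mset_swap_next sum_mset_sum_list)

lemma swap_next_eq_self:
  "\<mu> ! k = \<mu> ! (Suc k mod length \<mu>) \<Longrightarrow> swap_next k \<mu> = \<mu>"
  by (simp add: swap_next_def Let_def) (metis list_update_id)

lemma nth_swap_next:
  assumes "k < length \<mu>"
  shows "swap_next k \<mu> ! k = \<mu> ! (Suc k mod length \<mu>)"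
    "swap_next k \<mu> ! (Suc k mod length \<mu>) = \<mu> ! k"
  using assms Suc_mod_less[OF assms] by (auto simp: swap_next_def Let_def nth_list_update)

lemma swap_next_swap_next [simp]:
  assumes "k < length \<mu>"
  shows "swap_next k (swap_next k \<mu>) = \<mu>"
proof -
  show ?thesis
    using assms Suc_mod_less[OF assms]
    by (intro nth_equalityI) (auto simp: swap_next_def Let_def nth_list_update)
qed

lemma swap_next_in_dasep_states:
  assumes "n > 0" "\<mu> \<in> dasep_states n p q" "k < n"
  shows "swap_next k \<mu> \<in> dasep_states n p q"
proof -
  have "mset (swap_next k \<mu>) = mset \<mu>"
    using assms by (intro mset_swap_next) (simp add: dasep_states_iff)
  moreover from this have "set (swap_next k \<mu>) = set \<mu>"
    by (rule mset_eq_setD)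
  ultimately show ?thesis
    using assms by (simp add: dasep_states_iff num_parts_mset)
qed

lemma num_parts_list_update:
  "k < length \<mu> \<Longrightarrow> \<mu> ! k \<noteq> 0 \<Longrightarrow> j \<noteq> 0 \<Longrightarrow> num_parts (\<mu>[k := j]) = num_parts \<mu>"
  unfolding num_parts_def by (induction \<mu> arbitrary: k) (auto split: nat.split simp: nth_Cons)

lemma list_update_in_dasep_states:
  assumes "n > 0" "\<mu> \<in> dasep_states n p q" "k < n" "\<mu> ! k \<noteq> 0" "j \<noteq> 0" "j \<le> p"
  shows "\<mu>[k := j] \<in> dasep_states n p q"
  using assms set_update_subset_insert[of \<mu> k j]
  by (auto simp: dasep_states_iff num_parts_list_update)

lemma sum_list_update_nat:
  "k < length \<mu> \<Longrightarrow> sum_list (\<mu>[k := j]) + \<mu> ! k = sum_list \<mu> + (j :: nat)"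
  by (induction \<mu> arbitrary: k) (auto split: nat.split simp: nth_Cons)

lemma inj_list_update:
  assumes "\<And>k. k < length \<mu> \<Longrightarrow> g k \<noteq> \<mu> ! k"
  shows "inj_on (\<lambda>k. \<mu>[k := g k]) {..<length \<mu>}"
proof (rule inj_onI)
  fix k l
  assume *: "k \<in> {..<length \<mu>}" "l \<in> {..<length \<mu>}" "\<mu>[k := g k] = \<mu>[l := g l]"
  then have "\<mu>[k := g k] ! k = \<mu>[l := g l] ! k"
    by simp
  then show "k = l"
    using * assms[of k] by (metis lessThan_iff nth_list_update_eq nth_list_update_neq)
qed

section \<open>Sums over transitions and the generator\<close>

text \<open>
  The sum of \<open>H \<nu>\<close> over the transitions \<open>\<mu> \<rightarrow> \<nu>\<close>, weighted by their rates, with the common factor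
  \<open>1 / (3 n)\<close> dropped and \<open>c a b\<close> the rate of swapping neighbours \<open>a, b\<close>. The generator applied to
  \<open>F\<close> is \<open>jumps c p (\<lambda>\<nu>. F \<nu> - F \<mu>) \<mu>\<close>.
\<close>

definition jumps ::
    "(nat \<Rightarrow> nat \<Rightarrow> tu_poly) \<Rightarrow> nat \<Rightarrow> (nat list \<Rightarrow> tu_poly) \<Rightarrow> nat list \<Rightarrow> tu_poly" where
  "jumps c p H \<mu> =
     (\<Sum>k<length \<mu>. c (\<mu> ! k) (\<mu> ! (Suc k mod length \<mu>)) * H (swap_next k \<mu>)) +
     var_u * (\<Sum>k | k < length \<mu> \<and> \<mu> ! k \<in> {1..<p}. H (\<mu>[k := \<mu> ! k + 1])) +
     (\<Sum>k | k < length \<mu> \<and> \<mu> ! k \<ge> 2. H (\<mu>[k := \<mu> ! k - 1]))"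

definition hop_rate :: "nat \<Rightarrow> nat \<Rightarrow> tu_poly" where
  "hop_rate a b = (if a < b then 1 else if b < a then var_t else 0)"

text \<open>
  Swaps of two particles are suppressed: they do not affect the classes, and without them
  the measure \<open>\<mu> \<mapsto> u ^ sum_list \<mu>\<close> is stationary.
\<close>

definition hole_rate :: "nat \<Rightarrow> nat \<Rightarrow> tu_poly" where
  "hole_rate a b = hop_rate (of_bool (a \<noteq> 0)) (of_bool (b \<noteq> 0))"

text \<open>This passes from target states to bonds and sites. For \<open>n = 2\<close> two bonds
  can share a target, but \<open>hop_prob\<close> adds their probabilities, so the sum over bonds
  still counts correctly. Distinct promotions have distinct targets, and so do distinct
  demotions.\<close>

lemma sum_dasep_offdiag:
  assumes "n > 0" "\<mu> \<in> dasep_states n p q" "H \<mu> = 0"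
  shows "(\<Sum>\<nu>\<in>dasep_states n p q. dasep_offdiag n p \<mu> \<nu> * H \<nu>) =
    const_tu (1 / (3 * of_nat n)) * jumps hop_rate p H \<mu>"
proof -
  let ?G = "dasep_states n p q" and ?c = "const_tu (1 / (3 * of_nat n))"
  have fin: "finite ?G" and len: "length \<mu> = n"
    using assms finite_dasep_states by (auto simp: dasep_states_iff)
  have hop0: "hop_prob n \<mu> \<nu> = 0" if "sum_list \<nu> \<noteq> sum_list \<mu>" for \<nu>
    using that len by (auto simp: hop_prob_def Let_def intro!: sum.neutral)
  have pro: "sum_list \<nu> > sum_list \<mu>" if pr: "promotes p \<mu> \<nu>" for \<nu>
  proof -
    obtain k where "k < length \<mu>" "\<nu> = \<mu>[k := \<mu> ! k + 1]"
      using pr by (auto simp: promotes_def)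
    then show ?thesis
      using sum_list_update_nat[of k \<mu> "\<mu> ! k + 1"] by simp
  qed
  have dem: "sum_list \<nu> < sum_list \<mu>" if de: "demotes \<mu> \<nu>" for \<nu>
  proof -
    obtain k i where "k < length \<mu>" "\<mu> ! k = i + 1" "\<nu> = \<mu>[k := i]"
      using de by (auto simp: demotes_def)
    then show ?thesis
      using sum_list_update_nat[of k \<mu> "i"] by simp
  qed
  \<comment> \<open>The sum of the entries tells the three kinds of transitions apart, so at most
    one summand is nonzero and the nested conditional becomes a sum.\<close>
  have split: "dasep_offdiag n p \<mu> \<nu> = hop_prob n \<mu> \<nu> +
      var_u * ?c * of_bool (promotes p \<mu> \<nu>) + ?c * of_bool (demotes \<mu> \<nu>)" for \<nu>
    using hop0[of \<nu>] pro[of \<nu>] dem[of \<nu>] by (auto simp: dasep_offdiag_def)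
  have hop: "(\<Sum>\<nu>\<in>?G. hop_prob n \<mu> \<nu> * H \<nu>) =
      ?c * (\<Sum>k<n. hop_rate (\<mu> ! k) (\<mu> ! (Suc k mod n)) * H (swap_next k \<mu>))"
  proof -
    have "(\<Sum>\<nu>\<in>?G. hop_prob n \<mu> \<nu> * H \<nu>) =
        (\<Sum>\<nu>\<in>?G. \<Sum>k<n. if \<nu> = swap_next k \<mu>
           then ?c * (hop_rate (\<mu> ! k) (\<mu> ! (Suc k mod n)) * H \<nu>) else 0)"
      unfolding hop_prob_def sum_distrib_right
      by (intro sum.cong) (auto simp: Let_def hop_rate_def)
    also have "\<dots> = (\<Sum>k<n. \<Sum>\<nu>\<in>?G. if \<nu> = swap_next k \<mu>
           then ?c * (hop_rate (\<mu> ! k) (\<mu> ! (Suc k mod n)) * H \<nu>) else 0)"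
      by (rule sum.swap)
    also have "\<dots> = (\<Sum>k<n. ?c * (hop_rate (\<mu> ! k) (\<mu> ! (Suc k mod n)) * H (swap_next k \<mu>)))"
      using fin assms swap_next_in_dasep_states by (intro sum.cong) (auto simp: sum.delta')
    finally show ?thesis
      by (simp add: sum_distrib_left)
  qed
  have "(\<Sum>\<nu>\<in>?G. of_bool (promotes p \<mu> \<nu>) * H \<nu>) = (\<Sum>\<nu>\<in>{\<nu>\<in>?G. promotes p \<mu> \<nu>}. H \<nu>)"
    using fin by (intro sum.mono_neutral_cong_right) auto
  also have "{\<nu>\<in>?G. promotes p \<mu> \<nu>} =
      (\<lambda>k. \<mu>[k := \<mu> ! k + 1]) ` {k. k < length \<mu> \<and> \<mu> ! k \<in> {1..<p}}"
    using assms len by (force simp: promotes_def intro!: list_update_in_dasep_states)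
  also have "sum H \<dots> = (\<Sum>k | k < length \<mu> \<and> \<mu> ! k \<in> {1..<p}. H (\<mu>[k := \<mu> ! k + 1]))"
    by (rule sum.reindex_cong[OF inj_on_subset[OF inj_list_update]]) auto
  finally have promo: "(\<Sum>\<nu>\<in>?G. of_bool (promotes p \<mu> \<nu>) * H \<nu>) = \<dots>" .
  have "(\<Sum>\<nu>\<in>?G. of_bool (demotes \<mu> \<nu>) * H \<nu>) = (\<Sum>\<nu>\<in>{\<nu>\<in>?G. demotes \<mu> \<nu>}. H \<nu>)"
    using fin by (intro sum.mono_neutral_cong_right) auto
  also have "{\<nu>\<in>?G. demotes \<mu> \<nu>} =
      (\<lambda>k. \<mu>[k := \<mu> ! k - 1]) ` {k. k < length \<mu> \<and> \<mu> ! k \<ge> 2}" (is "?A = ?B")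
  proof
    show "?A \<subseteq> ?B"
    proof clarify
      fix \<nu> assume "demotes \<mu> \<nu>"
      then obtain k i where "k < length \<mu>" "i \<ge> 1" "\<mu> ! k = i + 1" "\<nu> = \<mu>[k := i]"
        by (auto simp: demotes_def)
      then show "\<nu> \<in> ?B"
        by (intro image_eqI[of _ _ k]) auto
    qed
    show "?B \<subseteq> ?A"
    proof (clarify, intro conjI)
      fix k assume k: "k < length \<mu>" "\<mu> ! k \<ge> 2"
      moreover have "\<mu> ! k \<le> p"
        using assms k by (auto simp: dasep_states_iff)
      ultimately show "\<mu>[k := \<mu> ! k - 1] \<in> ?G"
        using assms len by (intro list_update_in_dasep_states) auto
      show "demotes \<mu> (\<mu>[k := \<mu> ! k - 1])"
        unfolding demotes_def using k
        by (intro exI[of _ k] conjI exI[of _ "\<mu> ! k - 1"]) auto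
    qed
  qed
  also have "sum H \<dots> = (\<Sum>k | k < length \<mu> \<and> \<mu> ! k \<ge> 2. H (\<mu>[k := \<mu> ! k - 1]))"
  proof (rule sum.reindex_cong[OF _ refl refl])
    \<comment> \<open>\<open>inj_list_update\<close> does not apply here: at an empty site the
      truncated predecessor is the old entry 0.\<close>
    show "inj_on (\<lambda>k. \<mu>[k := \<mu> ! k - 1]) {k. k < length \<mu> \<and> \<mu> ! k \<ge> 2}"
      by (rule inj_onI) (metis (mono_tags, lifting) diff_less less_irrefl_nat mem_Collect_eq
          nth_list_update_eq nth_list_update_neq zero_less_numeral zero_less_one order.strict_trans2)
  qed
  finally have demo: "(\<Sum>\<nu>\<in>?G. of_bool (demotes \<mu> \<nu>) * H \<nu>) = \<dots>" .
  have "(\<Sum>\<nu>\<in>?G. dasep_offdiag n p \<mu> \<nu> * H \<nu>) =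
      (\<Sum>\<nu>\<in>?G. hop_prob n \<mu> \<nu> * H \<nu>) +
      var_u * ?c * (\<Sum>\<nu>\<in>?G. of_bool (promotes p \<mu> \<nu>) * H \<nu>) +
      ?c * (\<Sum>\<nu>\<in>?G. of_bool (demotes \<mu> \<nu>) * H \<nu>)"
    by (simp only: split sum_distrib_left ring_distribs sum.distrib mult.assoc)
  then show ?thesis
    unfolding hop promo demo jumps_def len by (simp add: algebra_simps)
qed

lemma const_tu_nonzero: "c \<noteq> 0 \<Longrightarrow> const_tu c \<noteq> 0"
  by (simp add: const_tu_def)

text \<open>This is stationarity tested against an arbitrary \<open>F\<close>. The diagonal of
  \<open>dasep_prob\<close> completes each row to 1, so applying the transition matrix to
  \<open>F\<close> and subtracting \<open>F\<close> leaves only differences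
  \<open>F \<nu> - F \<mu>\<close>.\<close>

lemma dasep_stationary_jumps:
  assumes "n > 0" "dasep_stationary n p q \<pi>"
  shows "(\<Sum>\<mu>\<in>dasep_states n p q. \<pi> \<mu> * jumps hop_rate p (\<lambda>\<nu>. F \<nu> - F \<mu>) \<mu>) = 0"
proof -
  let ?G = "dasep_states n p q" and ?c = "const_tu (1 / (3 * of_nat n))"
  have fin: "finite ?G"
    using assms finite_dasep_states by auto
  have *: "(\<Sum>\<nu>\<in>?G. dasep_prob n p q \<mu> \<nu> * F \<nu>) - F \<mu> =
      ?c * jumps hop_rate p (\<lambda>\<nu>. F \<nu> - F \<mu>) \<mu>" if \<mu>: "\<mu> \<in> ?G" for \<mu>
  proof -
    let ?o = "dasep_offdiag n p \<mu>"
    have "(\<Sum>\<nu>\<in>?G - {\<mu>}. dasep_prob n p q \<mu> \<nu> * F \<nu>) =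
        (\<Sum>\<nu>\<in>?G - {\<mu>}. ?o \<nu> * F \<nu>)"
      by (rule sum.cong) (auto simp: dasep_prob_def)
    then have "(\<Sum>\<nu>\<in>?G. dasep_prob n p q \<mu> \<nu> * F \<nu>) =
        (1 - (\<Sum>\<nu>\<in>?G - {\<mu>}. ?o \<nu>)) * F \<mu> + (\<Sum>\<nu>\<in>?G - {\<mu>}. ?o \<nu> * F \<nu>)"
      by (subst sum.remove[OF fin \<mu>]) (simp add: dasep_prob_def)
    also have "\<dots> = F \<mu> + (\<Sum>\<nu>\<in>?G - {\<mu>}. ?o \<nu> * (F \<nu> - F \<mu>))"
      by (simp add: algebra_simps sum_subtractf sum_distrib_left)
    also have "(\<Sum>\<nu>\<in>?G - {\<mu>}. ?o \<nu> * (F \<nu> - F \<mu>)) = (\<Sum>\<nu>\<in>?G. ?o \<nu> * (F \<nu> - F \<mu>))"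
      using sum.remove[OF fin \<mu>, of "\<lambda>\<nu>. ?o \<nu> * (F \<nu> - F \<mu>)"] by simp
    also have "\<dots> = ?c * jumps hop_rate p (\<lambda>\<nu>. F \<nu> - F \<mu>) \<mu>"
      using assms \<mu> by (intro sum_dasep_offdiag) auto
    finally show ?thesis
      by simp
  qed
  have "?c * (\<Sum>\<mu>\<in>?G. \<pi> \<mu> * jumps hop_rate p (\<lambda>\<nu>. F \<nu> - F \<mu>) \<mu>) =
      (\<Sum>\<mu>\<in>?G. \<pi> \<mu> * ((\<Sum>\<nu>\<in>?G. dasep_prob n p q \<mu> \<nu> * F \<nu>) - F \<mu>))"
    by (simp add: * sum_distrib_left mult.left_commute)
  also have "\<dots> = (\<Sum>\<mu>\<in>?G. \<Sum>\<nu>\<in>?G. \<pi> \<mu> * dasep_prob n p q \<mu> \<nu> * F \<nu>) - (\<Sum>\<mu>\<in>?G. \<pi> \<mu> * F \<mu>)"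
    by (simp add: right_diff_distrib sum_subtractf sum_distrib_left mult.assoc)
  also have "(\<Sum>\<mu>\<in>?G. \<Sum>\<nu>\<in>?G. \<pi> \<mu> * dasep_prob n p q \<mu> \<nu> * F \<nu>) =
      (\<Sum>\<nu>\<in>?G. (\<Sum>\<mu>\<in>?G. \<pi> \<mu> * dasep_prob n p q \<mu> \<nu>) * F \<nu>)"
    unfolding sum_distrib_right by (rule sum.swap)
  also have "\<dots> = (\<Sum>\<nu>\<in>?G. \<pi> \<nu> * F \<nu>)"
    using assms by (intro sum.cong) (auto simp: dasep_stationary_def)
  finally have "?c * (\<Sum>\<mu>\<in>?G. \<pi> \<mu> * jumps hop_rate p (\<lambda>\<nu>. F \<nu> - F \<mu>) \<mu>) = 0"
    by simp
  moreover have "?c \<noteq> 0"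
    using assms by (intro const_tu_nonzero) simp
  ultimately show ?thesis
    by simp
qed

section \<open>The product measure and its Dirichlet form\<close>

text \<open>If exactly one site is occupied, the two rates are \<open>1\<close> and
  \<open>t\<close>; otherwise both vanish. Being a difference of occupation numbers, the net rate
  cancels when summed around the ring.\<close>

lemma hole_term_eq:
  "(hole_rate b a - hole_rate a b) * (F :: tu_poly) =
    (1 - var_t) * F * (of_bool (a \<noteq> 0) - of_bool (b \<noteq> 0))"
  by (auto simp: hole_rate_def hop_rate_def algebra_simps)

lemma sum_Suc_mod:
  fixes f :: "nat \<Rightarrow> 'a::comm_monoid_add"
  assumes "n > 0"
  shows "(\<Sum>k<n. f (Suc k mod n)) = (\<Sum>k<n. f k)"
proof -
  obtain m where m: "n = Suc m"
    using assms by (cases n) auto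
  have "(\<Sum>k<n. f (Suc k mod n)) = (\<Sum>k<m. f (Suc k)) + f 0"
    unfolding m by (simp add: sum.lessThan_Suc)
  also have "\<dots> = (\<Sum>k<n. f k)"
    unfolding m by (subst sum.lessThan_Suc_shift) (simp add: add.commute)
  finally show ?thesis .
qed

lemma jumps_add: "jumps c p (\<lambda>\<nu>. H \<nu> + H' \<nu>) \<mu> = jumps c p H \<mu> + jumps c p H' \<mu>"
  by (simp add: jumps_def sum.distrib algebra_simps)

lemma jumps_mult: "jumps c p (\<lambda>\<nu>. x * H \<nu>) \<mu> = x * jumps c p H \<mu>"
  by (simp add: jumps_def sum_distrib_left algebra_simps)

text \<open>
  Promotions and demotions cancel by detailed balance. For the swaps, the difference between
  inflow and outflow at \<open>\<mu>\<close> is a sum around the ring of differences of occupation numbers.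
\<close>

lemma jumps_power_measure:
  assumes "n > 0"
  shows "(\<Sum>\<mu>\<in>dasep_states n p q.
    var_u ^ sum_list \<mu> * jumps hole_rate p (\<lambda>\<nu>. F \<nu> - F \<mu>) \<mu>) = 0"
proof -
  let ?G = "dasep_states n p q" and ?s = "\<lambda>\<mu>. var_u ^ sum_list \<mu>"
  let ?c = "\<lambda>\<mu> k. hole_rate (\<mu> ! k) (\<mu> ! (Suc k mod n))"
  let ?c' = "\<lambda>\<mu> k. hole_rate (\<mu> ! (Suc k mod n)) (\<mu> ! k)"
  have fin: "finite ?G" and len: "\<And>\<mu>. \<mu> \<in> ?G \<Longrightarrow> length \<mu> = n"
    using assms finite_dasep_states by (auto simp: dasep_states_iff)
  have "(\<Sum>\<mu>\<in>?G. \<Sum>k<n. ?s \<mu> * ?c \<mu> k * F (swap_next k \<mu>)) =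
      (\<Sum>k<n. \<Sum>\<mu>\<in>?G. ?s \<mu> * ?c \<mu> k * F (swap_next k \<mu>))"
    by (rule sum.swap)
  \<comment> \<open>Substitute \<open>swap_next k \<mu>\<close> for \<open>\<mu>\<close>: this
    involution of the states keeps the weight and exchanges the two entries, turning each rate into
    the reverse one.\<close>
  also have "\<dots> = (\<Sum>k<n. \<Sum>\<mu>\<in>?G. ?s \<mu> * ?c' \<mu> k * F \<mu>)"
  proof (rule sum.cong[OF refl])
    fix k assume "k \<in> {..<n}"
    then have k: "k < n"
      by simp
    have nth: "swap_next k \<mu> ! k = \<mu> ! (Suc k mod n)" "swap_next k \<mu> ! (Suc k mod n) = \<mu> ! k"
      if "\<mu> \<in> ?G" for \<mu>
      using nth_swap_next[of k \<mu>] k len[OF that] by simp_all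
    show "(\<Sum>\<mu>\<in>?G. ?s \<mu> * ?c \<mu> k * F (swap_next k \<mu>)) = (\<Sum>\<mu>\<in>?G. ?s \<mu> * ?c' \<mu> k * F \<mu>)"
      by (rule sum.reindex_bij_witness[of _ "swap_next k" "swap_next k"])
        (use k len assms nth swap_next_in_dasep_states in auto)
  qed
  also have "\<dots> = (\<Sum>\<mu>\<in>?G. \<Sum>k<n. ?s \<mu> * ?c' \<mu> k * F \<mu>)"
    by (rule sum.swap)
  finally have "(\<Sum>\<mu>\<in>?G. \<Sum>k<n. ?s \<mu> * ?c \<mu> k * (F (swap_next k \<mu>) - F \<mu>)) =
      (\<Sum>\<mu>\<in>?G. ?s \<mu> * (\<Sum>k<n. (?c' \<mu> k - ?c \<mu> k) * F \<mu>))"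
    by (simp add: algebra_simps sum_subtractf sum_distrib_left)
  also have "\<dots> = 0"
  proof -
    have "(\<Sum>k<n. (?c' \<mu> k - ?c \<mu> k) * F \<mu>) = (1 - var_t) * F \<mu> *
        ((\<Sum>k<n. of_bool (\<mu> ! k \<noteq> 0)) - (\<Sum>k<n. of_bool (\<mu> ! (Suc k mod n) \<noteq> 0)))" for \<mu>
      by (simp only: hole_term_eq sum_subtractf sum_distrib_left[symmetric])
    then have "(\<Sum>k<n. (?c' \<mu> k - ?c \<mu> k) * F \<mu>) = 0" for \<mu>
      using sum_Suc_mod[OF assms, of "\<lambda>k. of_bool (\<mu> ! k \<noteq> 0) :: tu_poly"] by simp
    then show ?thesis
      by simp
  qed
  finally have hop: "(\<Sum>\<mu>\<in>?G. \<Sum>k<n. ?s \<mu> * ?c \<mu> k * (F (swap_next k \<mu>) - F \<mu>)) = 0" .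

  let ?P = "Sigma ?G (\<lambda>\<mu>. {k. k < length \<mu> \<and> \<mu> ! k \<in> {1..<p}})"
  let ?D = "Sigma ?G (\<lambda>\<mu>. {k. k < length \<mu> \<and> \<mu> ! k \<ge> 2})"
  \<comment> \<open>Detailed balance: on pairs of a state and a site, demotion and promotion are
    mutually inverse, and the extra factor \<open>var_u\<close> makes up for the entry sum being
    smaller by one before the promotion.\<close>
  have "(\<Sum>(\<mu>, k)\<in>?D. ?s \<mu> * (F (\<mu>[k := \<mu> ! k - 1]) - F \<mu>)) =
      (\<Sum>(\<mu>, k)\<in>?P. - (?s \<mu> * var_u * (F (\<mu>[k := \<mu> ! k + 1]) - F \<mu>)))"
  proof (rule sum.reindex_bij_witness[of _ "\<lambda>(\<mu>, k). (\<mu>[k := \<mu> ! k + 1], k)"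
      "\<lambda>(\<mu>, k). (\<mu>[k := \<mu> ! k - 1], k)"], goal_cases)
    case (1 x)
    then show ?case by (auto split: prod.splits)
  next
    case (2 x)
    moreover have "\<mu> ! k \<le> p" if "\<mu> \<in> ?G" "k < length \<mu>" for \<mu> k
      using that assms by (auto simp: dasep_states_iff)
    ultimately show ?case
      using assms len by (fastforce intro!: list_update_in_dasep_states)
  next
    case (3 x)
    then show ?case by (auto split: prod.splits)
  next
    case (4 x)
    then show ?case
      using assms len by (auto intro!: list_update_in_dasep_states)
  next
    case (5 x)
    obtain \<mu> k where x: "x = (\<mu>, k)"
      by force
    have k: "k < length \<mu>" "\<mu> ! k \<ge> 2"
      using 5 x by auto
    have "sum_list \<mu> = Suc (sum_list (\<mu>[k := \<mu> ! k - 1]))"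
      using sum_list_update_nat[OF k(1), of "\<mu> ! k - 1"] k(2) by simp
    then show ?case
      using k unfolding x by (simp add: algebra_simps)
  qed
  then have "(\<Sum>(\<mu>, k)\<in>?P. ?s \<mu> * var_u * (F (\<mu>[k := \<mu> ! k + 1]) - F \<mu>)) +
      (\<Sum>(\<mu>, k)\<in>?D. ?s \<mu> * (F (\<mu>[k := \<mu> ! k - 1]) - F \<mu>)) = 0"
    by (simp add: split_def sum_negf)
  then have jump:
    "(\<Sum>\<mu>\<in>?G. \<Sum>k | k < length \<mu> \<and> \<mu> ! k \<in> {1..<p}.
        ?s \<mu> * var_u * (F (\<mu>[k := \<mu> ! k + 1]) - F \<mu>)) +
     (\<Sum>\<mu>\<in>?G. \<Sum>k | k < length \<mu> \<and> \<mu> ! k \<ge> 2. ?s \<mu> * (F (\<mu>[k := \<mu> ! k - 1]) - F \<mu>)) = 0"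
    using fin by (simp add: sum.Sigma)
  have "(\<Sum>\<mu>\<in>?G. ?s \<mu> * jumps hole_rate p (\<lambda>\<nu>. F \<nu> - F \<mu>) \<mu>) =
     (\<Sum>\<mu>\<in>?G. \<Sum>k<n. ?s \<mu> * ?c \<mu> k * (F (swap_next k \<mu>) - F \<mu>)) +
     ((\<Sum>\<mu>\<in>?G. \<Sum>k | k < length \<mu> \<and> \<mu> ! k \<in> {1..<p}.
        ?s \<mu> * var_u * (F (\<mu>[k := \<mu> ! k + 1]) - F \<mu>)) +
     (\<Sum>\<mu>\<in>?G. \<Sum>k | k < length \<mu> \<and> \<mu> ! k \<ge> 2. ?s \<mu> * (F (\<mu>[k := \<mu> ! k - 1]) - F \<mu>)))"
    unfolding sum.distrib[symmetric]
    by (intro sum.cong) (simp_all add: jumps_def len sum_distrib_left ring_distribs mult.assoc)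
  then show ?thesis
    using hop jump by simp
qed

text \<open>The order is by the sign of the leading coefficient, taken first in \<open>u\<close> and
  then in \<open>t\<close>.\<close>

lemma var_u_pos: "var_u > 0" and var_t_pos: "var_t > 0"
  by (simp_all add: var_u_def var_t_def less_poly_def pos_poly_def)

lemma hop_rate_nonneg: "hop_rate a b \<ge> 0"
  using var_t_pos by (auto simp: hop_rate_def)

text \<open>Expand the square as a difference of squares minus
  \<open>2 * r \<mu> * (r \<nu> - r \<mu>)\<close>. The weighted sum of the first part vanishes by
  stationarity of the power measure, that of the second by hypothesis.\<close>

lemma dirichlet_form_zero:
  assumes "n > 0"
    and zero: "(\<Sum>\<mu>\<in>dasep_states n p q.
      var_u ^ sum_list \<mu> * r \<mu> * jumps hole_rate p (\<lambda>\<nu>. r \<nu> - r \<mu>) \<mu>) = 0"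
    and \<mu>: "\<mu> \<in> dasep_states n p q"
  shows "jumps hole_rate p (\<lambda>\<nu>. (r \<nu> - r \<mu>)\<^sup>2) \<mu> = 0"
proof -
  let ?G = "dasep_states n p q" and ?J = "jumps hole_rate p"
  have nonneg: "?J (\<lambda>\<nu>. (r \<nu> - r \<mu>)\<^sup>2) \<mu> \<ge> 0" for \<mu>
    unfolding jumps_def hole_rate_def using var_u_pos
    by (intro add_nonneg_nonneg mult_nonneg_nonneg sum_nonneg hop_rate_nonneg) auto
  have expand: "?J (\<lambda>\<nu>. (r \<nu> - r \<mu>)\<^sup>2) \<mu> =
      ?J (\<lambda>\<nu>. (r \<nu>)\<^sup>2 - (r \<mu>)\<^sup>2) \<mu> - 2 * r \<mu> * ?J (\<lambda>\<nu>. r \<nu> - r \<mu>) \<mu>" for \<mu>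
  proof -
    have "(\<lambda>\<nu>. (r \<nu> - r \<mu>)\<^sup>2) =
        (\<lambda>\<nu>. ((r \<nu>)\<^sup>2 - (r \<mu>)\<^sup>2) + (- 2 * r \<mu>) * (r \<nu> - r \<mu>))"
      by (simp add: fun_eq_iff power2_eq_square algebra_simps)
    then show ?thesis
      by (simp only: jumps_add jumps_mult)
  qed
  have "(\<Sum>\<mu>\<in>?G. var_u ^ sum_list \<mu> * ?J (\<lambda>\<nu>. (r \<nu> - r \<mu>)\<^sup>2) \<mu>) =
      (\<Sum>\<mu>\<in>?G. var_u ^ sum_list \<mu> * ?J (\<lambda>\<nu>. (r \<nu>)\<^sup>2 - (r \<mu>)\<^sup>2) \<mu>) -
      2 * (\<Sum>\<mu>\<in>?G. var_u ^ sum_list \<mu> * r \<mu> * ?J (\<lambda>\<nu>. r \<nu> - r \<mu>) \<mu>)"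
    unfolding expand by (simp add: sum_subtractf sum_distrib_left algebra_simps)
  also have "\<dots> = 0"
    using zero jumps_power_measure[OF assms(1), where F = "\<lambda>\<nu>. (r \<nu>)\<^sup>2"] by simp
  \<comment> \<open>A vanishing sum of nonnegative terms has only zero terms.\<close>
  finally have "var_u ^ sum_list \<mu> * ?J (\<lambda>\<nu>. (r \<nu> - r \<mu>)\<^sup>2) \<mu> = 0"
    using \<mu> nonneg var_u_pos finite_dasep_states[OF assms(1)]
    by (subst (asm) sum_nonneg_eq_0_iff) auto
  then show ?thesis
    using var_u_pos by simp
qed

text \<open>Again nonnegative terms sum to zero. Exchanging a particle and a hole has rate
  \<open>1\<close> or \<open>t\<close>, both positive, so the edge is available whichever site is
  empty. A promotion is a demotion read from its other end.\<close>

lemma dirichlet_form_edges: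
  assumes zero: "jumps hole_rate p (\<lambda>\<nu>. (r \<nu> - r \<mu>)\<^sup>2) \<mu> = 0"
    and k: "k < length \<mu>"
  shows "(\<mu> ! k = 0) \<noteq> (\<mu> ! (Suc k mod length \<mu>) = 0) \<Longrightarrow> r (swap_next k \<mu>) = r \<mu>"
    and "\<mu> ! k \<ge> 2 \<Longrightarrow> r (\<mu>[k := \<mu> ! k - 1]) = r \<mu>"
proof -
  have nonneg: "hole_rate a b * x\<^sup>2 \<ge> 0" for a b and x :: tu_poly
    unfolding hole_rate_def by (intro mult_nonneg_nonneg hop_rate_nonneg) auto
  have 1: "(\<Sum>k<length \<mu>. hole_rate (\<mu> ! k) (\<mu> ! (Suc k mod length \<mu>)) *
      (r (swap_next k \<mu>) - r \<mu>)\<^sup>2) \<ge> 0" (is "?x \<ge> 0")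
    by (intro sum_nonneg nonneg)
  have 2: "var_u * (\<Sum>k | k < length \<mu> \<and> \<mu> ! k \<in> {1..<p}. (r (\<mu>[k := \<mu> ! k + 1]) - r \<mu>)\<^sup>2) \<ge> 0"
    (is "?y \<ge> 0")
    using var_u_pos by (intro mult_nonneg_nonneg sum_nonneg) auto
  have 3: "(\<Sum>k | k < length \<mu> \<and> \<mu> ! k \<ge> 2. (r (\<mu>[k := \<mu> ! k - 1]) - r \<mu>)\<^sup>2) \<ge> 0" (is "?z \<ge> 0")
    by (intro sum_nonneg) auto
  have "?x + ?y + ?z = 0"
    using zero by (simp add: jumps_def)
  then have xz: "?x = 0" "?z = 0"
    using 1 2 3 by (auto simp: add_nonneg_eq_0_iff)
  show "r (swap_next k \<mu>) = r \<mu>"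
    if "(\<mu> ! k = 0) \<noteq> (\<mu> ! (Suc k mod length \<mu>) = 0)"
  proof -
    have "hole_rate (\<mu> ! k) (\<mu> ! (Suc k mod length \<mu>)) * (r (swap_next k \<mu>) - r \<mu>)\<^sup>2 = 0"
      using xz(1) k nonneg by (subst (asm) sum_nonneg_eq_0_iff) auto
    moreover have "hole_rate (\<mu> ! k) (\<mu> ! (Suc k mod length \<mu>)) \<noteq> 0"
      using that var_t_pos by (auto simp: hole_rate_def hop_rate_def)
    ultimately show ?thesis
      by simp
  qed
  show "r (\<mu>[k := \<mu> ! k - 1]) = r \<mu>" if "\<mu> ! k \<ge> 2"
  proof -
    have "(r (\<mu>[k := \<mu> ! k - 1]) - r \<mu>)\<^sup>2 = 0"
      using xz(2) k that by (subst (asm) sum_nonneg_eq_0_iff) auto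
    then show ?thesis
      by simp
  qed
qed

section \<open>Classes of states\<close>

text \<open>The values are naturals rather than Booleans, so that the result is itself a binary word
  in the type of states and \<open>swap_next\<close> acts on it.\<close>

definition occupation :: "nat list \<Rightarrow> nat list" where
  "occupation = map (\<lambda>i. of_bool (i \<noteq> 0))"

text \<open>Its fibres are the sets over which the theorem sums \<open>\<pi>\<close>.\<close>

definition proj :: "nat list \<Rightarrow> nat list \<times> nat multiset" where
  "proj \<mu> = (occupation \<mu>, mset \<mu>)"

lemma occupation_eq_iff:
  "occupation xs = occupation ys \<longleftrightarrow>
    length xs = length ys \<and> (\<forall>i<length xs. xs ! i = 0 \<longleftrightarrow> ys ! i = 0)"
  by (auto simp: occupation_def list_eq_iff_nth_eq)

lemma occupation_swap_next:
  assumes "k < length \<mu>"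
  shows "occupation (swap_next k \<mu>) = swap_next k (occupation \<mu>)"
  using assms Suc_mod_less[OF assms]
  by (simp add: occupation_def swap_next_def Let_def map_update)

lemma occupation_list_update:
  "k < length \<mu> \<Longrightarrow> \<mu> ! k \<noteq> 0 \<Longrightarrow> j \<noteq> 0 \<Longrightarrow> occupation (\<mu>[k := j]) = occupation \<mu>"
  by (auto simp: occupation_eq_iff nth_list_update)

lemma occupation_binary: "set xs \<subseteq> {0, 1} \<Longrightarrow> occupation xs = xs"
  unfolding occupation_def by (rule map_idI) auto

lemma proj_swap_next:
  assumes "k < length \<mu>" "(\<mu> ! k = 0) = (\<mu> ! (Suc k mod length \<mu>) = 0)"
  shows "proj (swap_next k \<mu>) = proj \<mu>"
proof -
  have "occupation \<mu> ! k = occupation \<mu> ! (Suc k mod length (occupation \<mu>))"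
    using assms Suc_mod_less[OF assms(1)] by (simp add: occupation_def)
  then show ?thesis
    using assms(1) by (simp add: proj_def occupation_swap_next swap_next_eq_self)
qed

text \<open>The two rates differ only for two particles of different species; swapping these stays
  in the class of \<open>\<mu>\<close>, where \<open>H\<close> vanishes.\<close>

lemma jumps_hop_eq_hole:
  assumes "\<And>\<nu>. proj \<nu> = proj \<mu> \<Longrightarrow> H \<nu> = 0"
  shows "jumps hop_rate p H \<mu> = jumps hole_rate p H \<mu>"
proof -
  have *: "hop_rate (\<mu> ! k) (\<mu> ! (Suc k mod length \<mu>)) * H (swap_next k \<mu>) =
      hole_rate (\<mu> ! k) (\<mu> ! (Suc k mod length \<mu>)) * H (swap_next k \<mu>)" if "k < length \<mu>" for k
  proof (cases "(\<mu> ! k = 0) = (\<mu> ! (Suc k mod length \<mu>) = 0)")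
    case True
    then show ?thesis
      using that by (simp add: assms proj_swap_next)
  next
    case False
    then show ?thesis
      by (auto simp: hole_rate_def hop_rate_def)
  qed
  show ?thesis
    unfolding jumps_def by (intro arg_cong2[where f = "(+)"] sum.cong refl *) simp
qed

lemma sum_nth_eq_sum_mset: "(\<Sum>k<length xs. f (xs ! k)) = sum_mset (image_mset f (mset xs))"
proof -
  have "(\<Sum>k<length xs. f (xs ! k)) = sum_list (map f xs)"
    by (simp add: sum_list_sum_nth atLeast0LessThan)
  also have "\<dots> = sum_mset (mset (map f xs))"
    by (rule sum_mset_sum_list[symmetric])
  finally show ?thesis
    by simp
qed

text \<open>This is lumpability: the right-hand side sees \<open>\<mu>\<close> only through its
  class. Where a species change happens is irrelevant, so sums over sites become sums over the
  multiset of species.\<close>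

lemma jumps_hole_proj:
  "jumps hole_rate p (\<lambda>\<nu>. f (proj \<nu>)) \<mu> =
    (case proj \<mu> of (w, m) \<Rightarrow>
      (\<Sum>k<length w. hop_rate (w ! k) (w ! (Suc k mod length w)) * f (swap_next k w, m)) +
      var_u * (\<Sum>i\<in>#m. if i \<in> {1..<p} then f (w, add_mset (i + 1) (m - {#i#})) else 0) +
      (\<Sum>i\<in>#m. if i \<ge> 2 then f (w, add_mset (i - 1) (m - {#i#})) else 0))"
proof -
  have "(\<Sum>k<length \<mu>. hole_rate (\<mu> ! k) (\<mu> ! (Suc k mod length \<mu>)) * f (proj (swap_next k \<mu>))) =
      (\<Sum>k<length \<mu>. hop_rate (occupation \<mu> ! k) (occupation \<mu> ! (Suc k mod length \<mu>)) *
        f (swap_next k (occupation \<mu>), mset \<mu>))"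
    by (rule sum.cong)
      (auto simp: hole_rate_def proj_def occupation_swap_next Suc_mod_less,
        auto simp: occupation_def Suc_mod_less)
  moreover have "(\<Sum>k | k < length \<mu> \<and> \<mu> ! k \<in> {1..<p}. f (proj (\<mu>[k := \<mu> ! k + 1]))) =
      (\<Sum>i\<in>#mset \<mu>. if i \<in> {1..<p}
        then f (occupation \<mu>, add_mset (i + 1) (mset \<mu> - {#i#})) else 0)"
    unfolding sum_nth_eq_sum_mset[symmetric]
    by (rule sum.mono_neutral_cong_left) (auto simp: proj_def mset_update occupation_list_update)
  moreover have "(\<Sum>k | k < length \<mu> \<and> \<mu> ! k \<ge> 2. f (proj (\<mu>[k := \<mu> ! k - 1]))) =
      (\<Sum>i\<in>#mset \<mu>. if i \<ge> 2
        then f (occupation \<mu>, add_mset (i - 1) (mset \<mu> - {#i#})) else 0)"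
    unfolding sum_nth_eq_sum_mset[symmetric]
    by (rule sum.mono_neutral_cong_left) (auto simp: proj_def mset_update occupation_list_update)
  ultimately show ?thesis
    by (simp add: jumps_def proj_def) (simp add: occupation_def)
qed

text \<open>Dividing by the class size gives a function on states that can be compared pointwise
  with the product measure; the divisor is rational, so the values remain polynomials.\<close>

definition class_average :: "nat list set \<Rightarrow> (nat list \<Rightarrow> tu_poly) \<Rightarrow> nat list \<Rightarrow> tu_poly" where
  "class_average G \<pi> \<mu> = const_tu (1 / of_nat (card {\<nu>\<in>G. proj \<nu> = proj \<mu>})) *
     (\<Sum>\<nu> | \<nu> \<in> G \<and> proj \<nu> = proj \<mu>. \<pi> \<nu>)"

lemma const_tu_mult_of_nat: "m > 0 \<Longrightarrow> const_tu (1 / of_nat m) * of_nat m = 1"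
  by (simp add: const_tu_def of_nat_poly one_pCons)

text \<open>After the two sums are exchanged, each \<open>\<pi> \<nu>\<close> occurs once for every
  state of its class, divided by the class size.\<close>

lemma sum_class_average:
  assumes "finite G" and K: "\<And>\<mu> \<nu>. proj \<mu> = proj \<nu> \<Longrightarrow> K \<mu> = K \<nu>"
  shows "(\<Sum>\<mu>\<in>G. class_average G \<pi> \<mu> * K \<mu>) = (\<Sum>\<mu>\<in>G. \<pi> \<mu> * K \<mu>)"
proof -
  let ?c = "\<lambda>\<mu>. const_tu (1 / of_nat (card {\<nu>\<in>G. proj \<nu> = proj \<mu>}))"
  have "(\<Sum>\<mu>\<in>G. class_average G \<pi> \<mu> * K \<mu>) =
      (\<Sum>\<mu>\<in>G. \<Sum>\<nu>\<in>G. if proj \<nu> = proj \<mu> then ?c \<mu> * \<pi> \<nu> * K \<mu> else 0)"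
    unfolding class_average_def sum_distrib_left sum_distrib_right
    by (rule sum.cong[OF refl], rule sum.mono_neutral_cong_left) (use assms(1) in auto)
  also have "\<dots> = (\<Sum>\<nu>\<in>G. \<Sum>\<mu>\<in>G. if proj \<nu> = proj \<mu> then ?c \<mu> * \<pi> \<nu> * K \<mu> else 0)"
    by (rule sum.swap)
  also have "\<dots> = (\<Sum>\<nu>\<in>G. \<pi> \<nu> * K \<nu>)"
  proof (rule sum.cong[OF refl])
    fix \<nu> assume "\<nu> \<in> G"
    then have card: "card {\<mu>\<in>G. proj \<mu> = proj \<nu>} > 0"
      using assms(1) by (subst card_gt_0_iff) auto
    have "(\<Sum>\<mu>\<in>G. if proj \<nu> = proj \<mu> then ?c \<mu> * \<pi> \<nu> * K \<mu> else 0) =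
        (\<Sum>\<mu> | \<mu> \<in> G \<and> proj \<mu> = proj \<nu>. ?c \<nu> * \<pi> \<nu> * K \<nu>)"
    proof (rule sum.mono_neutral_cong_right)
      fix \<mu> assume "\<mu> \<in> {\<mu> \<in> G. proj \<mu> = proj \<nu>}"
      moreover from this have "K \<mu> = K \<nu>"
        by (intro K) simp
      ultimately show "(if proj \<nu> = proj \<mu> then ?c \<mu> * \<pi> \<nu> * K \<mu> else 0) = ?c \<nu> * \<pi> \<nu> * K \<nu>"
        by simp
    qed (use assms(1) in auto)
    also have "\<dots> = (?c \<nu> * of_nat (card {\<mu>\<in>G. proj \<mu> = proj \<nu>})) * (\<pi> \<nu> * K \<nu>)"
      by (simp add: algebra_simps)
    also have "\<dots> = \<pi> \<nu> * K \<nu>"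
      using card by (subst const_tu_mult_of_nat) auto
    finally show "(\<Sum>\<mu>\<in>G. if proj \<nu> = proj \<mu> then ?c \<mu> * \<pi> \<nu> * K \<mu> else 0) = \<pi> \<nu> * K \<nu>" .
  qed
  finally show ?thesis .
qed

section \<open>Rearrangements\<close>

lemma sum_list_le_num_parts: "(\<forall>i\<in>set \<mu>. i \<le> p) \<Longrightarrow> sum_list \<mu> \<le> p * num_parts \<mu>"
  by (induction \<mu>) (auto simp: num_parts_def)

lemma sum_list_ge_num_parts: "num_parts \<mu> \<le> sum_list \<mu>"
  by (induction \<mu>) (auto simp: num_parts_def)

text \<open>Adjacent transpositions generate all rearrangements. The hypothesis \<open>adj\<close>
  is restricted to lists with multiset \<open>M\<close> because it will be supplied only for
  states.\<close>

lemma invariant_under_mset: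
  assumes adj: "\<And>xs a b ys. mset (xs @ a # b # ys) = M \<Longrightarrow>
      h (xs @ a # b # ys) = h (xs @ b # a # ys)"
    and "mset xs = M" "mset ys = M"
  shows "h xs = h ys"
proof -
  have move: "h (zs @ us @ a # vs) = h (zs @ a # us @ vs)"
    if "mset (zs @ us @ a # vs) = M" for zs us a vs
    using that
  proof (induction us arbitrary: vs rule: rev_induct)
    case (snoc b us)
    have "h (zs @ (us @ [b]) @ a # vs) = h ((zs @ us) @ a # b # vs)"
      using adj[of "zs @ us" b a vs] snoc.prems by simp
    also have "\<dots> = h (zs @ a # us @ b # vs)"
      using snoc.IH[of "b # vs"] snoc.prems by (simp add: add_mset_commute)
    finally show ?case
      by simp
  qed simp
  \<comment> \<open>The common prefix \<open>zs\<close> is generalised so that the induction can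
    work on tails while \<open>adj\<close> speaks of whole lists.\<close>
  have "h (zs @ xs) = h (zs @ ys)" if "mset (zs @ xs) = M" "mset xs = mset ys" for zs
    using that
  proof (induction xs arbitrary: zs ys)
    case (Cons a xs)
    then have "a \<in> set ys"
      by (metis list.set_intros(1) mset_eq_setD)
    then obtain us vs where ys: "ys = us @ a # vs"
      by (meson split_list)
    have "h (zs @ a # xs) = h (zs @ a # us @ vs)"
      using Cons.IH[of "zs @ [a]" "us @ vs"] Cons.prems ys by simp
    also have "\<dots> = h (zs @ us @ a # vs)"
      using Cons.prems ys by (intro move[symmetric]) simp
    finally show ?case
      by (simp add: ys)
  qed simp
  from this[of "[]"] show ?thesis
    using assms by simp
qed

lemma swap_next_append: "swap_next (length xs) (xs @ a # b # ys) = xs @ b # a # ys"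
  by (simp add: swap_next_def Let_def nth_append list_update_append)

text \<open>Deleting the zeros is a bijection, since the support prescribes where to reinsert
  them.\<close>

lemma card_arrangements_on_support:
  assumes "0 \<notin># M" "size M = num_parts w"
  shows "card {\<mu>. occupation \<mu> = occupation w \<and> filter_mset (\<lambda>i. i \<noteq> 0) (mset \<mu>) = M} =
    card (permutations_of_multiset M)"
proof (rule bij_betw_same_card[of "filter (\<lambda>i. i \<noteq> 0)"], rule bij_betwI')
  fix xs ys
  assume "xs \<in> {\<mu>. occupation \<mu> = occupation w \<and> filter_mset (\<lambda>i. i \<noteq> 0) (mset \<mu>) = M}"
    "ys \<in> {\<mu>. occupation \<mu> = occupation w \<and> filter_mset (\<lambda>i. i \<noteq> 0) (mset \<mu>) = M}"
  then have "occupation xs = occupation ys"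
    by simp
  then show "(filter (\<lambda>i. i \<noteq> 0) xs = filter (\<lambda>i. i \<noteq> 0) ys) = (xs = ys)"
  proof (induction xs arbitrary: ys)
    case (Cons x xs)
    then show ?case
      by (cases ys) (auto simp: occupation_def split: if_splits)
  qed (simp add: occupation_def)
next
  fix xs
  assume "xs \<in> {\<mu>. occupation \<mu> = occupation w \<and> filter_mset (\<lambda>i. i \<noteq> 0) (mset \<mu>) = M}"
  then show "filter (\<lambda>i. i \<noteq> 0) xs \<in> permutations_of_multiset M"
    by (simp add: permutations_of_multiset_def)
next
  fix ys assume "ys \<in> permutations_of_multiset M"
  then have ys: "mset ys = M"
    by (simp add: permutations_of_multiset_def)
  have "\<exists>xs. occupation xs = occupation w \<and> filter (\<lambda>i. i \<noteq> 0) xs = ys"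
    if "0 \<notin> set ys" "length ys = num_parts w" for w
    using that
  proof (induction w arbitrary: ys)
    case (Cons x w)
    show ?case
    proof (cases "x = 0")
      case True
      then obtain xs where "occupation xs = occupation w" "filter (\<lambda>i. i \<noteq> 0) xs = ys"
        using Cons.IH[of ys] Cons.prems by (auto simp: num_parts_def)
      then show ?thesis
        using True by (intro exI[of _ "0 # xs"]) (simp add: occupation_def)
    next
      case False
      then obtain y ys' where y: "ys = y # ys'"
        using Cons.prems by (cases ys) (auto simp: num_parts_def)
      then obtain xs where "occupation xs = occupation w" "filter (\<lambda>i. i \<noteq> 0) xs = ys'"
        using Cons.IH[of ys'] Cons.prems False by (auto simp: num_parts_def)
      then show ?thesis
        using False Cons.prems y by (intro exI[of _ "y # xs"]) (auto simp: occupation_def)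
    qed
  qed (simp add: num_parts_def occupation_def)
  moreover have "0 \<notin> set ys" "length ys = num_parts w"
    using ys assms by auto
  ultimately obtain xs where xs: "occupation xs = occupation w" "filter (\<lambda>i. i \<noteq> 0) xs = ys"
    by metis
  then show "\<exists>xs\<in>{\<mu>. occupation \<mu> = occupation w \<and> filter_mset (\<lambda>i. i \<noteq> 0) (mset \<mu>) = M}.
      ys = filter (\<lambda>i. i \<noteq> 0) xs"
    using ys by (intro bexI[of _ xs]) (auto simp flip: mset_filter)
qed

section \<open>Constancy of the quotient\<close>

lemma class_average_cong: "proj \<mu> = proj \<nu> \<Longrightarrow> class_average G \<pi> \<mu> = class_average G \<pi> \<nu>"
  by (simp add: class_average_def)

lemma jumps_hole_cong:
  "proj \<mu> = proj \<nu> \<Longrightarrow>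
    jumps hole_rate p (\<lambda>x. f (proj x)) \<mu> = jumps hole_rate p (\<lambda>x. f (proj x)) \<nu>"
  by (simp only: jumps_hole_proj)

text \<open>
  \<open>r\<close> is the quotient of the averaged \<open>\<pi>\<close> by \<open>u ^ sum_list \<mu>\<close>, multiplied by \<open>u ^ (p * q)\<close> to stay
  in the polynomial ring; it is its own test function.
\<close>

lemma class_average_edges:
  fixes n p q \<pi>
  defines "G \<equiv> dasep_states n p q"
  defines "r \<equiv> \<lambda>\<mu>. var_u ^ (p * q - sum_list \<mu>) * class_average G \<pi> \<mu>"
  assumes "n > 0" "dasep_stationary n p q \<pi>" "\<mu> \<in> G"
  shows "jumps hole_rate p (\<lambda>\<nu>. (r \<nu> - r \<mu>)\<^sup>2) \<mu> = 0"
proof -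
  have r_cong: "r \<nu> = r \<nu>'" if "proj \<nu> = proj \<nu>'" for \<nu> \<nu>'
  proof -
    have "sum_list \<nu> = sum_list \<nu>'"
      using that by (metis proj_def prod.inject sum_mset_sum_list)
    then show ?thesis
      using class_average_cong[OF that] by (simp add: r_def)
  qed
  \<comment> \<open>Lumpability is stated for functions of the class, so \<open>r\<close> is
    factored through \<open>proj\<close>.\<close>
  then obtain f where f: "r = f \<circ> proj"
    by (metis function_factors_left)
  let ?K = "\<lambda>\<mu>. jumps hole_rate p (\<lambda>\<nu>. r \<nu> - r \<mu>) \<mu>"
  have K_cong: "?K \<nu> = ?K \<nu>'" if "proj \<nu> = proj \<nu>'" for \<nu> \<nu>'
    using jumps_hole_cong[OF that, of p "\<lambda>y. f y - f (proj \<nu>')"] that by (simp add: f)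
  have "0 = (\<Sum>\<mu>\<in>G. \<pi> \<mu> * jumps hop_rate p (\<lambda>\<nu>. r \<nu> - r \<mu>) \<mu>)"
    unfolding G_def using assms by (intro dasep_stationary_jumps[symmetric]) auto
  \<comment> \<open>Within a class \<open>r\<close> is constant, so swaps of two particles may be
    dropped.\<close>
  also have "\<dots> = (\<Sum>\<mu>\<in>G. \<pi> \<mu> * ?K \<mu>)"
    by (intro sum.cong refl arg_cong2[where f = "(*)"] jumps_hop_eq_hole) (auto dest: r_cong)
  also have "\<dots> = (\<Sum>\<mu>\<in>G. class_average G \<pi> \<mu> * ?K \<mu>)"
    unfolding G_def
    by (intro sum_class_average[symmetric] finite_dasep_states assms K_cong)
  finally have "0 = var_u ^ (p * q) * \<dots>"
    by simp
  also have "\<dots> = (\<Sum>\<mu>\<in>G. var_u ^ sum_list \<mu> * r \<mu> * ?K \<mu>)"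
    unfolding sum_distrib_left
  proof (rule sum.cong[OF refl])
    fix \<mu> assume "\<mu> \<in> G"
    \<comment> \<open>This bound makes the truncated subtraction in the exponent exact.\<close>
    then have "sum_list \<mu> \<le> p * q"
      using assms sum_list_le_num_parts[of \<mu> p] by (auto simp: dasep_states_iff)
    then have "var_u ^ (p * q) = var_u ^ sum_list \<mu> * var_u ^ (p * q - sum_list \<mu>)"
      by (simp flip: power_add)
    then show "var_u ^ (p * q) * (class_average G \<pi> \<mu> * ?K \<mu>) =
        var_u ^ sum_list \<mu> * r \<mu> * ?K \<mu>"
      by (simp only: r_def mult.assoc)
  qed
  finally show ?thesis
    using assms unfolding G_def by (intro dirichlet_form_zero) auto
qed

text \<open>The edges connect all states: demotions lead from a state to its occupation word, and
  adjacent swaps connect any two such words.\<close>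

lemma class_average_const:
  fixes n p q \<pi>
  defines "G \<equiv> dasep_states n p q"
  defines "r \<equiv> \<lambda>\<mu>. var_u ^ (p * q - sum_list \<mu>) * class_average G \<pi> \<mu>"
  assumes "n > 0" "dasep_stationary n p q \<pi>" "\<mu> \<in> G" "\<nu> \<in> G"
  shows "r \<mu> = r \<nu>"
proof -
  note G_iff = dasep_states_iff[OF \<open>n > 0\<close>]
  have edge: "jumps hole_rate p (\<lambda>\<nu>. (r \<nu> - r \<mu>)\<^sup>2) \<mu> = 0" if "\<mu> \<in> G" for \<mu>
    using class_average_edges[of n p q \<pi> \<mu>] assms that by simp
  have r_cong: "r \<nu> = r \<nu>'" if "proj \<nu> = proj \<nu>'" for \<nu> \<nu>'
  proof -
    have "sum_list \<nu> = sum_list \<nu>'"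
      using that by (metis proj_def prod.inject sum_mset_sum_list)
    then show ?thesis
      using class_average_cong[OF that] by (simp add: r_def)
  qed
  have demote: "r \<mu> = r (occupation \<mu>) \<and> occupation \<mu> \<in> G" if "\<mu> \<in> G" for \<mu>
    using that
  proof (induction "sum_list \<mu>" arbitrary: \<mu> rule: less_induct)
    case less
    show ?case
    proof (cases "set \<mu> \<subseteq> {0, 1}")
      case True
      then show ?thesis
        using less.prems by (simp add: occupation_binary)
    next
      case False
      then obtain k where k: "k < length \<mu>" "\<mu> ! k \<ge> 2"
        by (force simp: in_set_conv_nth subset_iff)
      let ?\<mu> = "\<mu>[k := \<mu> ! k - 1]"
      have "\<mu> ! k \<le> p"
        using less.prems k by (auto simp: G_def G_iff)
      then have le: "\<mu> ! k - 1 \<le> p"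
        by simp
      have "?\<mu> \<in> G"
        using less.prems k le assms(3) unfolding G_def
        by (intro list_update_in_dasep_states le) (auto simp: G_iff)
      moreover have "sum_list ?\<mu> < sum_list \<mu>"
        using sum_list_update_nat[OF k(1), of "\<mu> ! k - 1"] k(2) by simp
      moreover have "r ?\<mu> = r \<mu>"
        by (rule dirichlet_form_edges(2)[OF edge[OF less.prems] k])
      moreover have "occupation ?\<mu> = occupation \<mu>"
        using k by (intro occupation_list_update) auto
      ultimately show ?thesis
        using less.hyps[of ?\<mu>] by simp
    qed
  qed
  have "mset (occupation \<mu>) = mset (occupation \<nu>)"
  proof -
    have "mset (occupation x) = replicate_mset q 1 + replicate_mset (n - q) 0" if "x \<in> G" for x
    proof -
      have "mset (occupation x) =
          replicate_mset (num_parts x) 1 + replicate_mset (length x - num_parts x) 0" for x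
      proof (induction x)
        case (Cons a x)
        have "num_parts x \<le> length x"
          by (simp add: num_parts_def)
        then show ?case
          using Cons by (simp add: occupation_def num_parts_def Suc_diff_le)
      qed (simp add: occupation_def num_parts_def)
      then show ?thesis
        using that by (auto simp: G_def G_iff)
    qed
    then show ?thesis
      using assms by simp
  qed
  \<comment> \<open>Swapping a particle and a hole is an edge; any other swap stays in the
    class.\<close>
  moreover have "r (xs @ a # b # ys) = r (xs @ b # a # ys)"
    if m: "mset (xs @ a # b # ys) = mset (occupation \<nu>)" for xs a b ys
  proof -
    let ?\<mu> = "xs @ a # b # ys"
    have "?\<mu> \<in> G"
      using m demote[OF assms(6)] mset_eq_setD[OF m] mset_eq_length[OF m]
      by (simp add: G_def G_iff num_parts_mset)
    \<comment> \<open>This bond does not wrap around from the last site to the first.\<close>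
    moreover have "Suc (length xs) mod length ?\<mu> = Suc (length xs)"
      by simp
    ultimately show ?thesis
      using dirichlet_form_edges(1)[OF edge, of ?\<mu> "length xs"]
        r_cong[OF proj_swap_next[of "length xs" ?\<mu>]]
      by (cases "(a = 0) = (b = 0)") (simp_all add: swap_next_append nth_append)
  qed
  ultimately have "r (occupation \<mu>) = r (occupation \<nu>)"
    using invariant_under_mset[where h = r and M = "mset (occupation \<nu>)"] by blast
  then show ?thesis
    using demote assms by metis
qed

section \<open>Binary words and multinomial counts\<close>

lemma binary_words_iff:
  "w \<in> binary_words n q \<longleftrightarrow> mset w = replicate_mset q 1 + replicate_mset (n - q) 0"
  by (simp add: binary_words_def permutations_of_multiset_def)

text \<open>A binary word equals its own occupation word, so its class is a singleton.\<close>

lemma class_average_binary: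
  assumes "set w \<subseteq> {0, 1}" "w \<in> G"
  shows "class_average G \<pi> w = \<pi> w"
proof -
  have "\<nu> = w" if "proj \<nu> = proj w" for \<nu>
  proof -
    have "set \<nu> = set w"
      using that by (metis mset_eq_setD proj_def prod.inject)
    then show ?thesis
      using that assms occupation_binary by (metis proj_def prod.inject)
  qed
  then have "{\<nu>\<in>G. proj \<nu> = proj w} = {w}"
    using assms by auto
  then show ?thesis
    using const_tu_mult_of_nat[of 1] by (simp add: class_average_def)
qed

lemma sum_count_list_eq_num_parts:
  assumes "\<forall>i\<in>set xs. i \<le> p"
  shows "(\<Sum>i=1..p. count_list xs i) = num_parts xs"
  using assms
proof (induction xs)
  case (Cons x xs)
  have "(\<Sum>i=1..p. count_list (x # xs) i) =
      (\<Sum>i=1..p. (if i = x then 1 else 0) + count_list xs i)"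
    by (rule sum.cong) auto
  also have "\<dots> = (if x \<in> {1..p} then 1 else 0) + num_parts xs"
    using Cons by (simp add: sum.distrib)
  finally show ?case
    using Cons.prems by (auto simp: num_parts_def)
qed (simp add: num_parts_def)

lemma mem_rearrangements_supp_iff:
  assumes "length w = length lam"
  shows "\<mu> \<in> rearrangements_supp w lam \<longleftrightarrow> occupation \<mu> = occupation w \<and> mset \<mu> = mset lam"
proof (cases "mset \<mu> = mset lam")
  case True
  then have "length \<mu> = length lam"
    by (rule mset_eq_length)
  then show ?thesis
    using assms True
    unfolding rearrangements_supp_def permutations_of_multiset_def occupation_eq_iff by auto
qed (simp add: rearrangements_supp_def permutations_of_multiset_def)

text \<open>Equal length and an equal number of positive parts force the same number of zeros, so it
  suffices to compare the nonzero entries.\<close>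

lemma rearrangements_supp_eq:
  assumes "length w = length lam" "num_parts w = num_parts lam"
  shows "rearrangements_supp w lam = {\<mu>. occupation \<mu> = occupation w \<and>
    filter_mset (\<lambda>i. i \<noteq> 0) (mset \<mu>) = filter_mset (\<lambda>i. i \<noteq> 0) (mset lam)}" (is "_ = ?R")
proof
  show "rearrangements_supp w lam \<subseteq> ?R"
    using assms(1) by (auto simp: mem_rearrangements_supp_iff)
  show "?R \<subseteq> rearrangements_supp w lam"
  proof
    fix \<mu> assume \<mu>: "\<mu> \<in> ?R"
    then have len: "length \<mu> = length w"
      by (auto simp: occupation_eq_iff)
    have "count (mset \<mu>) 0 + num_parts \<mu> = length \<mu>" for \<mu> :: "nat list"
      by (induction \<mu>) (auto simp: num_parts_def)
    from this[of \<mu>] this[of lam] have "count (mset \<mu>) 0 = count (mset lam) 0"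
      using \<mu> len assms by (simp add: num_parts_mset)
    moreover have "count (mset \<mu>) i = count (mset lam) i" if "i \<noteq> 0" for i
      using \<mu> that by (metis (mono_tags, lifting) count_filter_mset mem_Collect_eq)
    ultimately have "mset \<mu> = mset lam"
      by (metis multiset_eqI)
    then show "\<mu> \<in> rearrangements_supp w lam"
      using \<mu> assms(1) by (simp add: mem_rearrangements_supp_iff)
  qed
qed

lemma card_rearrangements_supp:
  assumes "length w = length lam" "num_parts w = num_parts lam" "\<forall>i\<in>set lam. i \<le> p"
  shows "card (rearrangements_supp w lam) = multinomial p (count_list lam)"
proof -
  let ?M = "filter_mset (\<lambda>i. i \<noteq> 0) (mset lam)"
  have size: "size ?M = num_parts lam"
    by (simp add: num_parts_mset)
  have "card (rearrangements_supp w lam) = card (permutations_of_multiset ?M)"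
    using card_arrangements_on_support[of ?M w] size assms by (simp add: rearrangements_supp_eq)
  also have "\<dots> = fact (size ?M) div (\<Prod>i\<in>set_mset ?M. fact (count ?M i))"
    by (rule card_permutations_of_multiset)
  \<comment> \<open>Species that do not occur contribute the factor
    \<open>fact 0 = 1\<close>.\<close>
  also have "(\<Prod>i\<in>set_mset ?M. fact (count ?M i)) = (\<Prod>i=1..p. fact (count_list lam i) :: nat)"
  proof (rule prod.mono_neutral_cong_left)
    show "\<forall>i\<in>{1..p} - set_mset ?M. fact (count_list lam i) = (1 :: nat)"
    proof
      fix i assume "i \<in> {1..p} - set_mset ?M"
      then have "i \<notin> set lam"
        by auto
      then show "fact (count_list lam i) = (1 :: nat)"
        by (simp add: count_notin)
    qed
  qed (use assms(3) in \<open>auto simp: count_mset Suc_le_eq\<close>)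
  finally show ?thesis
    using size sum_count_list_eq_num_parts[OF assms(3)] by (simp add: multinomial_def)
qed

theorem theorem1p4:
  fixes n p q :: nat and \<pi> :: "nat list \<Rightarrow> tu_poly"
  assumes "n > 0" and "p > 0" and "q > 0" and "n > q"
    and "unnormalized_stationary n p q \<pi>"
  shows "(\<forall>w \<in> binary_words n q. \<forall>w' \<in> binary_words n q. \<pi> w = \<pi> w') \<and>
    (\<forall>w \<in> binary_words n q. \<forall>lam.
       is_partition n lam \<and> (\<forall>i \<in> set lam. i \<le> p) \<and> (\<Sum>i=1..p. count_list lam i) = q \<longrightarrow>
       (\<Sum>\<mu> \<in> rearrangements_supp w lam. \<pi> \<mu>)
         = var_u ^ (sum_list lam - q) * of_nat (card (rearrangements_supp w lam)) * \<pi> w \<and>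
       var_u ^ (sum_list lam - q) * of_nat (card (rearrangements_supp w lam)) * \<pi> w
         = var_u ^ (sum_list lam - q) * of_nat (multinomial p (count_list lam)) * \<pi> w)"
proof -
  let ?G = "dasep_states n p q"
  let ?r = "\<lambda>\<mu>. var_u ^ (p * q - sum_list \<mu>) * class_average ?G \<pi> \<mu>"
  note G_iff = dasep_states_iff[OF \<open>n > 0\<close>]
  have stat: "dasep_stationary n p q \<pi>"
    using assms by (simp add: unnormalized_stationary_def)
  have const: "?r \<mu> = ?r \<nu>" if "\<mu> \<in> ?G" "\<nu> \<in> ?G" for \<mu> \<nu>
    using class_average_const[OF \<open>n > 0\<close> stat that] .
  have word: "w \<in> ?G" "?r w = var_u ^ (p * q - q) * \<pi> w" "length w = n" "num_parts w = q"
    if "w \<in> binary_words n q" for w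
  proof -
    have m: "mset w = replicate_mset q 1 + replicate_mset (n - q) 0"
      using that by (simp add: binary_words_iff)
    then have "set w = set_mset (replicate_mset q 1 + replicate_mset (n - q) 0)"
      by (metis set_mset_mset)
    then have s: "set w \<subseteq> {0, 1}"
      by (auto split: if_splits)
    show len: "length w = n"
      using m \<open>n > q\<close> by (metis le_add_diff_inverse less_imp_le_nat size_mset size_replicate_mset size_union)
    have "filter_mset P (replicate_mset k i) = (if P i then replicate_mset k i else {#})"
      for P k and i :: nat
      by (induction k) auto
    then show np: "num_parts w = q"
      using m by (simp add: num_parts_mset)
    show G: "w \<in> ?G"
      using len np s \<open>p > 0\<close> by (auto simp: G_iff)
    have "sum_list w = q"
      using m by (metis sum_mset_sum_list sum_mset.union sum_mset_replicate_mset mult.right_neutral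
          mult_zero_right add.right_neutral of_nat_id)
    then show "?r w = var_u ^ (p * q - q) * \<pi> w"
      using class_average_binary[OF s G] by simp
  qed
  have u0: "var_u \<noteq> 0"
    using var_u_pos by simp
  have "\<pi> w = \<pi> w'" if "w \<in> binary_words n q" "w' \<in> binary_words n q" for w w'
    using const[OF word(1)[OF that(1)] word(1)[OF that(2)]] u0
    unfolding word(2)[OF that(1)] word(2)[OF that(2)] by simp
  moreover have "(\<Sum>\<mu>\<in>rearrangements_supp w lam. \<pi> \<mu>) =
        var_u ^ (sum_list lam - q) * of_nat (card (rearrangements_supp w lam)) * \<pi> w \<and>
      card (rearrangements_supp w lam) = multinomial p (count_list lam)"
    if w: "w \<in> binary_words n q" and "is_partition n lam" and le: "\<forall>i\<in>set lam. i \<le> p"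
      and "(\<Sum>i=1..p. count_list lam i) = q" for w lam
  proof -
    let ?S = "rearrangements_supp w lam"
    have len: "length lam = n" and np: "num_parts lam = q"
      using that sum_count_list_eq_num_parts[OF le] by (simp_all add: is_partition_def)
    have card: "card ?S = multinomial p (count_list lam)"
      using len np le word(3,4)[OF w] by (intro card_rearrangements_supp) simp_all
    have eq: "?S = {\<mu>. occupation \<mu> = occupation w \<and> mset \<mu> = mset lam}"
      using len word(3)[OF w]
      by (auto simp: mem_rearrangements_supp_iff)
    have "card ?S = card (permutations_of_multiset (filter_mset (\<lambda>i. i \<noteq> 0) (mset lam)))"
      using card_arrangements_on_support[of "filter_mset (\<lambda>i. i \<noteq> 0) (mset lam)" w]
        len np word(3,4)[OF w] by (simp add: rearrangements_supp_eq num_parts_mset)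
    also have "\<dots> > 0"
      by (subst card_gt_0_iff) simp
    finally have pos: "card ?S > 0" .
    then obtain \<mu> where \<mu>: "\<mu> \<in> ?S"
      by fastforce
    have sub: "?S \<subseteq> ?G"
    proof
      fix \<nu> assume "\<nu> \<in> ?S"
      then have "mset \<nu> = mset lam"
        by (simp add: eq)
      then have "length \<nu> = length lam" "set \<nu> = set lam" "num_parts \<nu> = num_parts lam"
        by (auto simp: num_parts_mset dest: mset_eq_length mset_eq_setD)
      then show "\<nu> \<in> ?G"
        using len np le by (simp add: G_iff)
    qed
    have sum: "sum_list \<mu> = sum_list lam"
      using \<mu> eq by (metis (mono_tags, lifting) mem_Collect_eq sum_mset_sum_list)
    have "{\<nu>\<in>?G. proj \<nu> = proj \<mu>} = ?S"
      using \<mu> sub by (auto simp: eq proj_def)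
    then have "of_nat (card ?S) * class_average ?G \<pi> \<mu> =
        (const_tu (1 / of_nat (card ?S)) * of_nat (card ?S)) * (\<Sum>\<nu>\<in>?S. \<pi> \<nu>)"
      by (simp add: class_average_def)
    then have avg: "of_nat (card ?S) * class_average ?G \<pi> \<mu> = (\<Sum>\<nu>\<in>?S. \<pi> \<nu>)"
      unfolding const_tu_mult_of_nat[OF pos] by simp
    \<comment> \<open>Both bounds are needed to split the exponent under truncated subtraction.
      Comparing \<open>?r\<close> at \<open>\<mu>\<close> and at \<open>w\<close>, the common power
      of \<open>u\<close> then cancels.\<close>
    have "q \<le> sum_list lam" "sum_list lam \<le> p * q"
      using sum_list_ge_num_parts[of lam] sum_list_le_num_parts[OF le] np by simp_all
    then have "var_u ^ (p * q - q) = var_u ^ (p * q - sum_list lam) * var_u ^ (sum_list lam - q)"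
      by (simp flip: power_add)
    moreover have "var_u ^ (p * q - sum_list lam) * class_average ?G \<pi> \<mu> = var_u ^ (p * q - q) * \<pi> w"
      using const[of \<mu> w] \<mu> sub word(1,2)[OF w] sum by (metis subsetD)
    ultimately have "class_average ?G \<pi> \<mu> = var_u ^ (sum_list lam - q) * \<pi> w"
      using u0 by (simp add: mult.assoc)
    then show ?thesis
      using avg card by (simp add: algebra_simps)
  qed
  ultimately show ?thesis
    by metis
qed

end
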